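(* Let $t\geqslant 3$ be an integer and $K\geqslant 1$ a constant. There exist constants $c_1$ and $m_0$ (depending on $t$ and $K$) such that the following holds. Let $\chi$ be a proper edge-coloring of $G=K_n$, let $X_1,X_2,X_3,X_4$ be a partition of $V(G)$, and let $\mathcal{G}$ be the auxiliary graph defined below. Let $\mathcal{G}_0$ be a subgraph of $\mathcal{G}$ which is bipartite with parts $A$ and $B$ (where $A$ is contained in one side of $\mathcal{G}$ and $B$ in the other), with $|B|=m\geqslant m_0$, $\frac{1}{2}|B|\leqslant|A|\leqslant 2|B|$, and such that every vertex of $\mathcal{G}_0$ has degree between $\delta$ and $K\delta$, where $\delta\geqslant c_1 m^{\frac{t-2}{2t-3}}$. Then $\mathcal{G}_0$ contains a copy of $H_t$ in which the vertices are pairwise disjoint.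
   Context: $\mathcal{G}$ is the bipartite graph with vertex set $(X_1\times X_2)\cup(X_3\times X_4)$, in which $(x_1,x_2)\in X_1\times X_2$ is adjacent to $(x_3,x_4)\in X_3\times X_4$ if and only if the edges $x_1x_3$ and $x_2x_4$ of $G$ have the same color under $\chi$. Each vertex $(a,b)$ of $\mathcal{G}$ is regarded as the set $\{a,b\}\subseteq V(G)$. $H_t$ is the $1$-subdivision of $K_t$ (each edge of $K_t$ replaced by a path of length $2$). A copy of $H_t$ in $\mathcal{G}_0$ "in which the vertices are pairwise disjoint" means a subgraph of $\mathcal{G}_0$ isomorphic to $H_t$ whose vertices, regarded as $2$-element subsets of $V(G)$, are pairwise disjoint. *)

theory Defs
  imports Complex_Main
begin

record 'a graph =
  verts :: "'a set"
  edges :: "'a set set"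

definition simple_graph :: "'a graph \<Rightarrow> bool" where
  "simple_graph G \<longleftrightarrow> (\<forall>e\<in>edges G. e \<subseteq> verts G \<and> card e = 2)"

definition subgraph :: "'a graph \<Rightarrow> 'a graph \<Rightarrow> bool" where
  "subgraph H G \<longleftrightarrow> simple_graph H \<and> verts H \<subseteq> verts G \<and> edges H \<subseteq> edges G"

definition degree :: "'a graph \<Rightarrow> 'a \<Rightarrow> nat" where
  "degree G v = card {e \<in> edges G. v \<in> e}"

definition bipartite_with :: "'a graph \<Rightarrow> 'a set \<Rightarrow> 'a set \<Rightarrow> bool" where
  "bipartite_with G A B \<longleftrightarrow>
     verts G = A \<union> B \<and> A \<inter> B = {} \<and> (\<forall>e\<in>edges G. \<exists>a\<in>A. \<exists>b\<in>B. e = {a, b})"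

definition isomorphic :: "'a graph \<Rightarrow> 'b graph \<Rightarrow> bool" where
  "isomorphic G H \<longleftrightarrow> (\<exists>f. bij_betw f (verts G) (verts H) \<and>
     (\<forall>u\<in>verts G. \<forall>v\<in>verts G. {u, v} \<in> edges G \<longleftrightarrow> {f u, f v} \<in> edges H))"

definition complete_graph :: "nat \<Rightarrow> nat graph" where
  "complete_graph n = \<lparr>verts = {..<n}, edges = {e. e \<subseteq> {..<n} \<and> card e = 2}\<rparr>"

text \<open>The middle vertex of the path that replaces the edge \<open>e\<close> is \<open>Inr e\<close>.\<close>

definition subdivision1 :: "'a graph \<Rightarrow> ('a + 'a set) graph" where
  "subdivision1 G = \<lparr>verts = Inl ` verts G \<union> Inr ` edges G,
                     edges = {{Inl v, Inr e} | v e. e \<in> edges G \<and> v \<in> e}\<rparr>"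

definition subdivided_clique :: "nat \<Rightarrow> (nat + nat set) graph" where
  "subdivided_clique t = subdivision1 (complete_graph t)"

definition proper_edge_colouring :: "'a graph \<Rightarrow> ('a set \<Rightarrow> 'c) \<Rightarrow> bool" where
  "proper_edge_colouring G \<chi> \<longleftrightarrow>
     (\<forall>e\<in>edges G. \<forall>f\<in>edges G. e \<noteq> f \<and> e \<inter> f \<noteq> {} \<longrightarrow> \<chi> e \<noteq> \<chi> f)"

text \<open>Parts may be empty. Since \<open>disjnt\<close> is symmetric, \<open>sorted_wrt disjnt Xs\<close> says that
  the entries at different positions of \<open>Xs\<close> are disjoint.\<close>

definition partition_into :: "'a set \<Rightarrow> 'a set list \<Rightarrow> bool" where
  "partition_into V Xs \<longleftrightarrow> \<Union>(set Xs) = V \<and> sorted_wrt disjnt Xs"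

definition aux_graph ::
  "('a set \<Rightarrow> 'c) \<Rightarrow> 'a set \<Rightarrow> 'a set \<Rightarrow> 'a set \<Rightarrow> 'a set \<Rightarrow> ('a \<times> 'a) graph" where
  "aux_graph \<chi> X\<^sub>1 X\<^sub>2 X\<^sub>3 X\<^sub>4 =
     \<lparr>verts = (X\<^sub>1 \<times> X\<^sub>2) \<union> (X\<^sub>3 \<times> X\<^sub>4),
      edges = {{(x\<^sub>1, x\<^sub>2), (x\<^sub>3, x\<^sub>4)} | x\<^sub>1 x\<^sub>2 x\<^sub>3 x\<^sub>4.
                 x\<^sub>1 \<in> X\<^sub>1 \<and> x\<^sub>2 \<in> X\<^sub>2 \<and> x\<^sub>3 \<in> X\<^sub>3 \<and> x\<^sub>4 \<in> X\<^sub>4 \<and>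
                 \<chi> {x\<^sub>1, x\<^sub>3} = \<chi> {x\<^sub>2, x\<^sub>4}}\<rparr>"

definition pair_set :: "'a \<times> 'a \<Rightarrow> 'a set" where
  "pair_set p = {fst p, snd p}"

definition pairwise_disjoint_verts :: "('a \<times> 'a) graph \<Rightarrow> bool" where
  "pairwise_disjoint_verts H \<longleftrightarrow> pairwise (\<lambda>p q. disjnt (pair_set p) (pair_set q)) (verts H)"

end

theory Submission
  imports Defs "HOL-Analysis.Convex"
begin

text \<open>
  This is Janzer's argument for the extremal number of the subdivided clique, with "distinct"
  replaced by "disjoint". Since the colouring is proper, the neighbours of any vertex of the
  auxiliary graph are pairwise disjoint pairs, so a fixed pair meets at most two of them.

  Call two vertices of \<open>A\<close> light if they have between \<open>1\<close> and \<open>t\<^sup>2 - 1\<close> common neighbours and heavy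
  if they have more. If \<open>t\<close> vertices are pairwise heavy, disjoint common neighbours can be chosen
  greedily. Otherwise Turan's theorem, applied in the neighbourhood of every vertex of \<open>B\<close>, shows
  that every large \<open>U \<subseteq> A\<close> contains a vertex with at least about \<open>\<delta>\<^sup>2 |U| / m\<close> light partners in \<open>U\<close>.
  Passing to these partners \<open>t - 1\<close> times gives a light clique. At each step only \<open>O(\<delta>)\<close> vertices
  are discarded to keep common neighbours of different pairs disjoint, which is affordable exactly
  when \<open>\<delta>\<close> is at least a large multiple of \<open>m powr ((t - 2) / (2 * t - 3))\<close>.
\<close>

section \<open>Turan's theorem as a lower bound on closed degrees\<close>

text \<open>Induction on \<open>r\<close>: delete a vertex \<open>v\<close> of least closed degree
  together with its closed neighbourhood \<open>C\<close>. What remains contains only smaller sets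
  of pairwise unrelated vertices, since \<open>v\<close> could be added to them. By the choice of
  \<open>v\<close> every vertex of \<open>C\<close> has closed degree at least
  \<open>card C\<close>, so \<open>C\<close> contributes at least \<open>card C * card C\<close> to
  the sum.\<close>

lemma turan_closed_degree_sum:
  fixes L :: "'a \<Rightarrow> 'a \<Rightarrow> bool"
  assumes "finite S" and refl: "\<And>x. L x x" and sym: "\<And>x y. L x y \<Longrightarrow> L y x"
    and "\<And>I. I \<subseteq> S \<Longrightarrow> card I = Suc r \<Longrightarrow> \<exists>x\<in>I. \<exists>y\<in>I. x \<noteq> y \<and> L x y"
  shows "(card S)\<^sup>2 \<le> r * (\<Sum>x\<in>S. card {y\<in>S. L x y})"
  using assms(1,4)
proof (induction r arbitrary: S)
  case 0
  have "S = {}"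
  proof (rule ccontr)
    assume "S \<noteq> {}"
    then obtain x where "x \<in> S" by blast
    then show False using 0(2)[of "{x}"] by simp
  qed
  then show ?case by simp
next
  case (Suc r)
  show ?case
  proof (cases "S = {}")
    case False
    define d where "d x = card {y\<in>S. L x y}" for x
    obtain v where v: "v \<in> S" and vmin: "\<And>x. x \<in> S \<Longrightarrow> d v \<le> d x"
      using False Suc.prems(1)
      by (metis arg_min_if_finite(1) arg_min_least)
    define C where "C = {y\<in>S. L v y}"
    define S' where "S' = S - C"
    define P where "P = (\<Sum>x\<in>S'. card {y\<in>S'. L x y})"
    have fin: "finite C" "finite S'" using Suc.prems(1) by (auto simp: C_def S'_def)
    have IH: "(card S')\<^sup>2 \<le> r * P"
      unfolding P_def
    proof (rule Suc.IH[OF fin(2)])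
      fix I assume I: "I \<subseteq> S'" "card I = Suc r"
      have "finite I" using I(2) card.infinite by fastforce
      have vI: "v \<notin> I" using I(1) refl v by (auto simp: S'_def C_def)
      \<comment> \<open>\<open>v\<close> is unrelated to all of \<open>S'\<close>, so a related pair
        of distinct vertices in \<open>insert v I\<close> lies in \<open>I\<close>.\<close>
      obtain x y where xy: "x \<in> insert v I" "y \<in> insert v I" "x \<noteq> y" "L x y"
        using Suc.prems(2)[of "insert v I"] I v vI \<open>finite I\<close> by (auto simp: S'_def)
      have "\<not> L v z" if "z \<in> I" for z using that I(1) by (auto simp: S'_def C_def)
      then show "\<exists>x\<in>I. \<exists>y\<in>I. x \<noteq> y \<and> L x y" using xy sym by blast
    qed
    have S: "S = C \<union> S'" "C \<inter> S' = {}" by (auto simp: S'_def C_def)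
    have cardS: "card S = card C + card S'" using S fin by (simp add: card_Un_disjoint)
    have "(\<Sum>x\<in>S. d x) = (\<Sum>x\<in>C. d x) + (\<Sum>x\<in>S'. d x)"
      using S fin by (metis sum.union_disjoint)
    moreover have "card C * card C \<le> (\<Sum>x\<in>C. d x)"
    proof -
      have "(\<Sum>x\<in>C. card C) \<le> (\<Sum>x\<in>C. d x)"
        by (intro sum_mono) (use vmin in \<open>auto simp: C_def d_def\<close>)
      then show ?thesis by simp
    qed
    moreover have "P \<le> (\<Sum>x\<in>S'. d x)"
      unfolding P_def d_def
      by (intro sum_mono card_mono) (use Suc.prems(1) in \<open>auto simp: S'_def\<close>)
    ultimately have sum_ge: "card C * card C + P \<le> (\<Sum>x\<in>S. d x)" by linarith
    define k y p where "k = real (card C)" and "y = real (card S')" and "p = real P"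
    have yrp: "y\<^sup>2 \<le> real r * p"
      using IH unfolding y_def p_def by (metis of_nat_le_iff of_nat_mult of_nat_power)
    have "(k + y)\<^sup>2 \<le> (real r + 1) * (k * k + p)"
    proof -
      \<comment> \<open>For positive \<open>r\<close> this is the AM-GM inequality for
        \<open>r * k\<close> and \<open>y\<close>, divided by \<open>r\<close>. For
        \<open>r = 0\<close> the induction hypothesis forces \<open>y = 0\<close>.\<close>
      have "2 * k * y \<le> real r * k\<^sup>2 + p"
      proof (cases "r = 0")
        case True
        then show ?thesis using yrp by (simp add: p_def)
      next
        case False
        have "real r * (2 * k * y) \<le> (real r * k)\<^sup>2 + y\<^sup>2"
          using sum_squares_bound[of "real r * k" y] by (simp add: algebra_simps)
        also have "\<dots> \<le> (real r * k)\<^sup>2 + real r * p" using yrp by simp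
        also have "\<dots> = real r * (real r * k\<^sup>2 + p)"
          by (simp add: power2_eq_square algebra_simps)
        finally show ?thesis using False by simp
      qed
      then show ?thesis using yrp by (simp add: power2_eq_square algebra_simps)
    qed
    then have "real ((card S)\<^sup>2) \<le> real (Suc r * (card C * card C + P))"
      by (simp add: cardS k_def y_def p_def algebra_simps)
    then have "(card S)\<^sup>2 \<le> Suc r * (card C * card C + P)" by (simp only: of_nat_le_iff)
    also have "\<dots> \<le> Suc r * (\<Sum>x\<in>S. d x)" using sum_ge by (rule mult_le_mono2)
    finally show ?thesis unfolding d_def .
  qed simp
qed

lemma card_UN_bound:
  assumes "finite I" "card I \<le> a" "\<And>i. i \<in> I \<Longrightarrow> card (F i) \<le> b"
  shows "card (\<Union>i\<in>I. F i) \<le> a * b"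
proof -
  have "card (\<Union>i\<in>I. F i) \<le> (\<Sum>i\<in>I. card (F i))" by (rule card_UN_le[OF assms(1)])
  also have "\<dots> \<le> card I * b" using sum_bounded_above[of I "\<lambda>i. card (F i)" b] assms(3) by simp
  also have "\<dots> \<le> a * b" using assms(2) by simp
  finally show ?thesis .
qed

section \<open>Heavy cliques and light degrees in a bipartite graph with conflicts\<close>

text \<open>This isolates what the search for a copy uses of the auxiliary graph. In the application
  \<open>conf w w'\<close> says that the pairs \<open>w\<close> and \<open>w'\<close> meet; by
  reflexivity, absence of conflict includes being distinct. The bound 2 in \<open>card_conf\<close>
  arises because each of the two points of \<open>w\<close> lies in at most one neighbour of
  \<open>x\<close>.\<close>

locale conflict_bipartite =
  fixes A :: "'a set" and B :: "'b set" and E :: "'a \<Rightarrow> 'b \<Rightarrow> bool"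
    and conf :: "'b \<Rightarrow> 'b \<Rightarrow> bool"
  assumes finite_A: "finite A" and finite_B: "finite B"
    and conf_refl: "\<And>w. conf w w" and conf_sym: "\<And>w w'. conf w w' \<Longrightarrow> conf w' w"
    and conf_nbrs: "\<And>x w w'. \<lbrakk>x \<in> A; w \<in> B; w' \<in> B; E x w; E x w'; conf w w'\<rbrakk> \<Longrightarrow> w = w'"
    and card_conf: "\<And>x w. \<lbrakk>x \<in> A; w \<in> B\<rbrakk> \<Longrightarrow> card {w'\<in>B. E x w' \<and> conf w w'} \<le> 2"
begin

definition N :: "'a \<Rightarrow> 'b set" where "N x = {w\<in>B. E x w}"
definition M :: "'b \<Rightarrow> 'a set" where "M w = {x\<in>A. E x w}"

definition light :: "nat \<Rightarrow> 'a \<Rightarrow> 'a \<Rightarrow> bool" where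
  "light s x y \<longleftrightarrow> x \<noteq> y \<and> N x \<inter> N y \<noteq> {} \<and> card (N x \<inter> N y) < s"

text \<open>A copy of the subdivided clique with branch vertices \<open>T\<close> and middle
  vertices \<open>g e\<close>. Only conflicts among middle vertices are excluded here: in the
  application two branch vertices are disjoint because they share a neighbour, and a branch vertex
  and a middle vertex are disjoint because they use different parts of the partition.\<close>

definition spaced_copy :: "nat \<Rightarrow> bool" where
  "spaced_copy t \<longleftrightarrow> (\<exists>T g. T \<subseteq> A \<and> card T = t \<and>
     (\<forall>e. e \<subseteq> T \<and> card e = 2 \<longrightarrow> g e \<in> B \<and> (\<forall>x\<in>e. E x (g e))) \<and>
     (\<forall>e e'. e \<subseteq> T \<and> card e = 2 \<and> e' \<subseteq> T \<and> card e' = 2 \<and> e \<noteq> e' \<longrightarrow> \<not> conf (g e) (g e')))"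

lemma finite_N: "finite (N x)" using finite_B by (simp add: N_def)
lemma finite_M: "finite (M w)" using finite_A by (simp add: M_def)

lemma light_sym: "light s x y \<Longrightarrow> light s y x"
  by (auto simp: light_def Int_commute)

text \<open>Since \<open>S e\<close> lies in one neighbourhood, each representative already chosen
  conflicts with at most two elements of \<open>S e\<close>. So fewer than \<open>2 * card F\<close>
  elements are ever blocked.\<close>

lemma greedy_representatives:
  assumes "finite F"
    and "\<And>e. e \<in> F \<Longrightarrow> S e \<subseteq> B \<and> 2 * card F \<le> card (S e)"
    and "\<And>e. e \<in> F \<Longrightarrow> \<exists>x\<in>A. S e \<subseteq> N x"
  shows "\<exists>g. (\<forall>e\<in>F. g e \<in> S e) \<and> (\<forall>e\<in>F. \<forall>e'\<in>F. e \<noteq> e' \<longrightarrow> \<not> conf (g e) (g e'))"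
  using assms
proof (induction F)
  case (insert e F)
  have "\<exists>g. (\<forall>e\<in>F. g e \<in> S e) \<and> (\<forall>e\<in>F. \<forall>e'\<in>F. e \<noteq> e' \<longrightarrow> \<not> conf (g e) (g e'))"
  proof (rule insert.IH)
    fix e' assume "e' \<in> F"
    then show "S e' \<subseteq> B \<and> 2 * card F \<le> card (S e')" "\<exists>x\<in>A. S e' \<subseteq> N x"
      using insert.prems(1,2)[of e'] insert.hyps by auto
  qed
  then obtain g where g: "\<And>e. e \<in> F \<Longrightarrow> g e \<in> S e"
    "\<And>e e'. e \<in> F \<Longrightarrow> e' \<in> F \<Longrightarrow> e \<noteq> e' \<Longrightarrow> \<not> conf (g e) (g e')" by blast
  obtain x where x: "x \<in> A" "S e \<subseteq> N x" using insert.prems(2)[of e] by auto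
  define Z where "Z = (\<Union>e'\<in>F. {w\<in>B. E x w \<and> conf (g e') w})"
  have gB: "g e' \<in> B" if "e' \<in> F" for e' using g(1)[OF that] insert.prems(1)[of e'] that by auto
  have "card Z \<le> (\<Sum>e'\<in>F. card {w\<in>B. E x w \<and> conf (g e') w})"
    unfolding Z_def by (rule card_UN_le[OF insert.hyps(1)])
  also have "\<dots> \<le> (\<Sum>e'\<in>F. 2)" by (rule sum_mono) (rule card_conf[OF x(1) gB])
  also have "\<dots> < 2 * card (insert e F)" using insert.hyps by simp
  also have "\<dots> \<le> card (S e)" using insert.prems(1)[of e] by simp
  finally have "card Z < card (S e)" .
  moreover have "finite Z" using finite_B insert.hyps(1) by (auto simp: Z_def)
  ultimately have "\<not> S e \<subseteq> Z" using card_mono[of Z "S e"] by linarith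
  then obtain w where w: "w \<in> S e" "w \<notin> Z" by blast
  have nc: "\<not> conf (g e') w" if "e' \<in> F" for e'
    using w that x(2) by (auto simp: Z_def N_def)
  show ?case
    by (rule exI[of _ "g(e := w)"]) (use g w(1) nc insert.hyps in \<open>auto dest: conf_sym\<close>)
qed simp

lemma spaced_copy_of_heavy_clique:
  assumes T: "T \<subseteq> A" "card T = t"
    and heavy: "\<And>x y. x \<in> T \<Longrightarrow> y \<in> T \<Longrightarrow> x \<noteq> y \<Longrightarrow> t\<^sup>2 \<le> card (N x \<inter> N y)"
  shows "spaced_copy t"
proof -
  define F where "F = {e. e \<subseteq> T \<and> card e = 2}"
  define S where "S e = (\<Inter>x\<in>e. N x)" for e
  have "finite T" using T finite_A finite_subset by blast
  then have finF: "finite F" by (auto simp: F_def)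
  \<comment> \<open>There are \<open>t * (t - 1) / 2\<close> pairs and the greedy choice needs two
    elements of \<open>S e\<close> for each of them; this is the source of the threshold
    \<open>t\<^sup>2\<close> between light and heavy.\<close>
  have cF: "2 * card F \<le> t\<^sup>2"
    using n_subsets[OF \<open>finite T\<close>, of 2] T(2)
    by (simp add: F_def choose_two power2_eq_square)
       (metis diff_le_self le_trans mult_le_mono2 times_div_less_eq_dividend)
  have "\<exists>g. (\<forall>e\<in>F. g e \<in> S e) \<and> (\<forall>e\<in>F. \<forall>e'\<in>F. e \<noteq> e' \<longrightarrow> \<not> conf (g e) (g e'))"
  proof (rule greedy_representatives[OF finF])
    fix e assume "e \<in> F"
    then obtain x y where e: "e = {x, y}" "x \<noteq> y" "x \<in> T" "y \<in> T"
      by (auto simp: F_def card_2_iff)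
    have Se: "S e = N x \<inter> N y" by (auto simp: S_def e)
    show "S e \<subseteq> B \<and> 2 * card F \<le> card (S e)"
      unfolding Se using heavy[OF e(3,4,2)] cF by (auto simp: N_def)
    show "\<exists>x\<in>A. S e \<subseteq> N x" unfolding Se using e T by blast
  qed
  then obtain g where g: "\<forall>e\<in>F. g e \<in> S e"
    "\<forall>e\<in>F. \<forall>e'\<in>F. e \<noteq> e' \<longrightarrow> \<not> conf (g e) (g e')" by (elim exE conjE)
  have "g e \<in> B \<and> (\<forall>x\<in>e. E x (g e))" if "e \<in> F" for e
  proof -
    have "e \<noteq> {}" using that by (auto simp: F_def)
    then show ?thesis using g(1) that by (fastforce simp: S_def N_def)
  qed
  then show ?thesis
    unfolding spaced_copy_def using T g(2)
    by (intro exI[of _ T] exI[of _ g]) (auto simp: F_def)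
qed

text \<open>Double counting of pairs in \<open>U\<close> that are not heavy, weighted by their
  common neighbours. Below, Turan's theorem in each \<open>M w \<inter> U\<close> and Cauchy-Schwarz
  over \<open>w\<close> give at least \<open>(\<delta> * card U)\<^sup>2 / (t * card B)\<close>.
  Above, the diagonal gives at most \<open>D * card U\<close> and each light pair less than
  \<open>t\<^sup>2\<close>. The lower bound on \<open>card U\<close> keeps the diagonal at no more
  than half of the total.\<close>

lemma exists_light_degree_ge:
  fixes \<delta> D :: real
  assumes "\<not> spaced_copy t" "t \<ge> 1" "\<delta> > 0" "B \<noteq> {}"
    and degA: "\<And>x. x \<in> A \<Longrightarrow> \<delta> \<le> card (N x) \<and> card (N x) \<le> D"
    and U: "U \<subseteq> A" "U \<noteq> {}" "2 * D * t * card B / \<delta>\<^sup>2 \<le> card U"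
  shows "\<exists>u\<in>U. \<delta>\<^sup>2 * card U / (2 * t * t\<^sup>2 * card B) \<le> card {v\<in>U. light (t\<^sup>2) u v}"
proof (rule ccontr)
  assume "\<not> ?thesis"
  then have few: "card {v\<in>U. light (t\<^sup>2) u v} < \<delta>\<^sup>2 * card U / (2 * t * t\<^sup>2 * card B)"
    if "u \<in> U" for u using that by force
  define m where "m = card B"
  \<comment> \<open>The diagonal is included because the Turan bound is for closed degrees. Pairs
    without common neighbours are included too; they never occur inside a set
    \<open>M w\<close>.\<close>
  define L where "L x y \<longleftrightarrow> x = y \<or> card (N x \<inter> N y) < t\<^sup>2" for x y
  define P where "P w = (\<Sum>x\<in>M w \<inter> U. card {y\<in>M w \<inter> U. L x y})" for w
  have finU: "finite U" using U finite_A finite_subset by blast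
  have m: "m > 0" using \<open>B \<noteq> {}\<close> finite_B by (auto simp: m_def card_gt_0_iff)
  have Pw: "(card (M w \<inter> U))\<^sup>2 \<le> t * P w" for w
  proof -
    have "(card (M w \<inter> U))\<^sup>2 \<le> (t - 1) * P w"
      unfolding P_def
    proof (rule turan_closed_degree_sum)
      fix I assume I: "I \<subseteq> M w \<inter> U" "card I = Suc (t - 1)"
      \<comment> \<open>Otherwise \<open>I\<close> would consist of \<open>t\<close> pairwise heavy
        vertices and yield a copy.\<close>
      show "\<exists>x\<in>I. \<exists>y\<in>I. x \<noteq> y \<and> L x y"
        using spaced_copy_of_heavy_clique[of I t] I \<open>t \<ge> 1\<close> \<open>\<not> spaced_copy t\<close> U(1)
        by (fastforce simp: L_def not_less)
    qed (use finU in \<open>auto simp: L_def Int_commute\<close>)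
    also have "\<dots> \<le> t * P w" by simp
    finally show ?thesis .
  qed
  have double: "(\<Sum>w\<in>B. card (M w \<inter> U)) = (\<Sum>x\<in>U. card (N x))"
  proof -
    have "(\<Sum>w\<in>B. card (M w \<inter> U)) = (\<Sum>w\<in>B. \<Sum>x\<in>U. if E x w then 1 else 0)"
      by (intro sum.cong refl) (use finU U(1) in \<open>auto simp: M_def simp flip: sum.inter_filter intro!: arg_cong[where f = card]\<close>)
    also have "\<dots> = (\<Sum>x\<in>U. \<Sum>w\<in>B. if E x w then 1 else 0)" by (rule sum.swap)
    also have "\<dots> = (\<Sum>x\<in>U. card (N x))"
      by (intro sum.cong refl) (use finite_B in \<open>auto simp: N_def simp flip: sum.inter_filter\<close>)
    finally show ?thesis .
  qed
  have "\<delta> * card U \<le> (\<Sum>x\<in>U. real (card (N x)))"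
    using sum_bounded_below[of U \<delta> "\<lambda>x. real (card (N x))"] degA U(1)
    by (auto simp: mult.commute)
  also have "\<dots> = (\<Sum>w\<in>B. real (card (M w \<inter> U)))"
    using double by (metis of_nat_sum)
  finally have lower: "\<delta> * card U \<le> (\<Sum>w\<in>B. real (card (M w \<inter> U)))" .
  have "(\<delta> * card U)\<^sup>2 \<le> (\<Sum>w\<in>B. real (card (M w \<inter> U)))\<^sup>2"
    using lower \<open>\<delta> > 0\<close> by (intro power_mono) auto
  also have "\<dots> \<le> m * (\<Sum>w\<in>B. (real (card (M w \<inter> U)))\<^sup>2)"
    using sum_squared_le_sum_of_squares[of "\<lambda>w. real (card (M w \<inter> U))" B]
    by (simp add: m_def mult.commute)
  also have "\<dots> \<le> m * (\<Sum>w\<in>B. real (t * P w))"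
    by (intro mult_left_mono sum_mono) (use Pw in \<open>auto simp flip: of_nat_power of_nat_mult\<close>)
  also have "\<dots> = m * t * (\<Sum>w\<in>B. real (P w))" by (simp add: sum_distrib_left mult.assoc)
  finally have low: "(\<delta> * card U)\<^sup>2 \<le> m * t * (\<Sum>w\<in>B. real (P w))" .
  \<comment> \<open>Both sides count the triples \<open>(x, y, w)\<close> where \<open>L x y\<close>
    holds and \<open>w\<close> is a common neighbour of \<open>x\<close> and
    \<open>y\<close>.\<close>
  have Psum: "(\<Sum>w\<in>B. P w) = (\<Sum>x\<in>U. \<Sum>y\<in>U. if L x y then card (N x \<inter> N y) else 0)"
  proof -
    have "P w = (\<Sum>x\<in>U. \<Sum>y\<in>U. if L x y \<and> E x w \<and> E y w then 1 else 0)" for w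
    proof -
      have "P w = (\<Sum>x\<in>U. if E x w then card {y\<in>M w \<inter> U. L x y} else 0)"
        unfolding P_def using finU U(1)
        by (subst sum.inter_filter[symmetric]) (auto simp: M_def intro!: sum.cong)
      also have "\<dots> = (\<Sum>x\<in>U. \<Sum>y\<in>U. if L x y \<and> E x w \<and> E y w then 1 else 0)"
        by (intro sum.cong refl) (use finU U(1) in \<open>auto simp: M_def simp flip: sum.inter_filter intro!: arg_cong[where f = card]\<close>)
      finally show ?thesis .
    qed
    then have "(\<Sum>w\<in>B. P w) = (\<Sum>w\<in>B. \<Sum>x\<in>U. \<Sum>y\<in>U. if L x y \<and> E x w \<and> E y w then 1 else 0)"
      by simp
    also have "\<dots> = (\<Sum>x\<in>U. \<Sum>w\<in>B. \<Sum>y\<in>U. if L x y \<and> E x w \<and> E y w then 1 else 0)"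
      by (rule sum.swap)
    also have "\<dots> = (\<Sum>x\<in>U. \<Sum>y\<in>U. \<Sum>w\<in>B. if L x y \<and> E x w \<and> E y w then 1 else 0)"
      by (intro sum.cong refl) (rule sum.swap)
    also have "\<dots> = (\<Sum>x\<in>U. \<Sum>y\<in>U. if L x y then card (N x \<inter> N y) else 0)"
      by (intro sum.cong refl) (use finite_B in \<open>auto simp: N_def simp flip: sum.inter_filter intro!: arg_cong[where f = card]\<close>)
    finally show ?thesis .
  qed
  have row: "(\<Sum>y\<in>U. if L x y then card (N x \<inter> N y) else 0)
      \<le> card (N x) + t\<^sup>2 * card {v\<in>U. light (t\<^sup>2) x v}" if "x \<in> U" for x
  proof -
    have "(\<Sum>y\<in>U. if L x y then card (N x \<inter> N y) else 0)
        \<le> (\<Sum>y\<in>U. (if y = x then card (N x) else 0) + (if light (t\<^sup>2) x y then t\<^sup>2 else 0))"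
      by (rule sum_mono) (auto simp: L_def light_def)
    also have "\<dots> = card (N x) + t\<^sup>2 * card {v\<in>U. light (t\<^sup>2) x v}"
      using finU that by (simp add: sum.distrib flip: sum.inter_filter)
    finally show ?thesis .
  qed
  \<comment> \<open>With this \<open>b\<close> the light pairs account for exactly half of
    \<open>(\<delta> * card U)\<^sup>2\<close> in the upper bound.\<close>
  define b where "b = \<delta>\<^sup>2 * card U / (2 * t * t\<^sup>2 * m)"
  have "(\<Sum>w\<in>B. real (P w)) = real (\<Sum>w\<in>B. P w)" by simp
  also have "\<dots> = (\<Sum>x\<in>U. real (\<Sum>y\<in>U. if L x y then card (N x \<inter> N y) else 0))"
    unfolding Psum by simp
  also have "\<dots> < (\<Sum>x\<in>U. D + t\<^sup>2 * b)"
  proof (rule sum_strict_mono[OF finU U(2)])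
    fix x assume x: "x \<in> U"
    have "real (\<Sum>y\<in>U. if L x y then card (N x \<inter> N y) else 0)
        \<le> real (card (N x) + t\<^sup>2 * card {v\<in>U. light (t\<^sup>2) x v})"
      using row[OF x] of_nat_le_iff by blast
    also have "\<dots> = card (N x) + t\<^sup>2 * real (card {v\<in>U. light (t\<^sup>2) x v})" by simp
    also have "\<dots> < D + t\<^sup>2 * b"
      using few[OF x] degA[of x] x U(1) \<open>t \<ge> 1\<close>
      by (intro add_le_less_mono mult_strict_left_mono) (auto simp: b_def m_def)
    finally show "real (\<Sum>y\<in>U. if L x y then card (N x \<inter> N y) else 0) < D + t\<^sup>2 * b" .
  qed
  also have "\<dots> = card U * D + card U * (t\<^sup>2 * b)" by (simp add: algebra_simps)
  finally have "m * t * (\<Sum>w\<in>B. real (P w)) < m * t * (card U * D + card U * (t\<^sup>2 * b))"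
    using m \<open>t \<ge> 1\<close> by (intro mult_strict_left_mono) auto
  with low have "(\<delta> * card U)\<^sup>2 < m * t * (card U * D + card U * (t\<^sup>2 * b))" by linarith
  also have "\<dots> = m * t * D * card U + (\<delta> * card U)\<^sup>2 / 2"
    using m \<open>t \<ge> 1\<close> by (simp add: b_def field_simps power2_eq_square)
  finally have "\<delta>\<^sup>2 * card U * card U < 2 * D * t * m * card U"
    by (simp add: power2_eq_square algebra_simps)
  moreover have "2 * D * t * m \<le> \<delta>\<^sup>2 * card U"
    using U(3) \<open>\<delta> > 0\<close> by (simp add: m_def field_simps)
  then have "2 * D * t * m * card U \<le> \<delta>\<^sup>2 * card U * card U"
    by (rule mult_right_mono) simp
  ultimately show False by linarith
qed

section \<open>Light cliques whose common neighbours do not conflict\<close>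

text \<open>The condition compares all common neighbours of an old pair \<open>x\<close>,
  \<open>y\<close> with all common neighbours of a new pair \<open>z\<close>, \<open>v\<close>, so
  that middle vertices may later be chosen arbitrarily. Here \<open>z\<close> may be
  \<open>x\<close> or \<open>y\<close>; with \<open>w = w'\<close> this rules out a common neighbour
  of \<open>x\<close>, \<open>y\<close> and \<open>v\<close>.\<close>

definition extends :: "nat \<Rightarrow> 'a list \<Rightarrow> 'a \<Rightarrow> bool" where
  "extends s xs v \<longleftrightarrow> v \<in> A \<and> (\<forall>x\<in>set xs. light s x v) \<and>
     (\<forall>x\<in>set xs. \<forall>y\<in>set xs. x \<noteq> y \<longrightarrow>
        (\<forall>z\<in>set xs. \<forall>w\<in>N x \<inter> N y. \<forall>w'\<in>N z \<inter> N v. \<not> conf w w'))"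

fun spread :: "nat \<Rightarrow> 'a list \<Rightarrow> bool" where
  "spread s [] \<longleftrightarrow> True"
| "spread s (v # xs) \<longleftrightarrow> spread s xs \<and> extends s xs v"

lemma spread_distinct: "spread s xs \<Longrightarrow> distinct xs \<and> set xs \<subseteq> A"
  by (induction xs) (auto simp: extends_def light_def)

lemma spread_light:
  "spread s xs \<Longrightarrow> x \<in> set xs \<Longrightarrow> y \<in> set xs \<Longrightarrow> x \<noteq> y \<Longrightarrow> light s x y"
  by (induction xs) (auto simp: extends_def intro: light_sym)

text \<open>Induction on the list, by whether none, one or both of the two pairs contain the newest
  vertex. Only the last case is not covered by the induction hypothesis or by
  \<open>extends\<close>.\<close>

lemma spread_no_conf:
  assumes "spread s xs" "x \<in> set xs" "y \<in> set xs" "z \<in> set xs" "v \<in> set xs"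
    "x \<noteq> y" "z \<noteq> v" "{x, y} \<noteq> {z, v}" "w \<in> N x \<inter> N y" "w' \<in> N z \<inter> N v"
  shows "\<not> conf w w'"
  using assms
proof (induction xs arbitrary: x y z v w w')
  case (Cons a xs)
  have ext: "\<not> conf p p'"
    if "x \<in> set xs" "y \<in> set xs" "x \<noteq> y" "z \<in> set xs" "p \<in> N x \<inter> N y" "p' \<in> N z \<inter> N a"
    for x y z p p'
    using Cons.prems(1) that unfolding spread.simps extends_def by blast
  \<comment> \<open>Here \<open>p\<close> and \<open>p'\<close> are neighbours of \<open>a\<close>,
    so a conflict makes them equal. Then \<open>p\<close> is a common neighbour of \<open>x\<close>,
    \<open>z\<close> and \<open>a\<close>, which \<open>extends\<close> excludes.\<close>
  have both: "\<not> conf p p'"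
    if "x \<in> set xs" "z \<in> set xs" "x \<noteq> z" "p \<in> N x \<inter> N a" "p' \<in> N z \<inter> N a" for x z p p'
  proof
    assume "conf p p'"
    moreover have "a \<in> A" using Cons.prems(1) by (simp add: extends_def)
    ultimately have "p = p'" using conf_nbrs[of a p p'] that by (auto simp: N_def)
    then show False using ext[of x z x p p'] that conf_refl by auto
  qed
  have comm: "w \<in> N y \<inter> N x" "w' \<in> N v \<inter> N z" using Cons.prems by auto
  consider "x \<in> set xs" "y \<in> set xs" "z \<in> set xs" "v \<in> set xs"
    | "x \<in> set xs" "y \<in> set xs" "z = a \<and> v \<in> set xs \<or> v = a \<and> z \<in> set xs"
    | "x = a \<and> y \<in> set xs \<or> y = a \<and> x \<in> set xs" "z \<in> set xs" "v \<in> set xs"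
    | "x = a \<and> y \<in> set xs \<or> y = a \<and> x \<in> set xs" "z = a \<and> v \<in> set xs \<or> v = a \<and> z \<in> set xs"
    using Cons.prems by auto
  then show ?case
  proof cases
    case 1
    then show ?thesis using Cons.IH[of x y z v w w'] Cons.prems by simp
  next
    case 2
    then show ?thesis using ext[of x y] Cons.prems(6,9,10) comm by blast
  next
    case 3
    then show ?thesis using ext[of z v] Cons.prems(7,9,10) comm conf_sym by blast
  next
    case 4
    obtain x' where x': "x' \<in> set xs" "{x, y} = {x', a}" "w \<in> N x' \<inter> N a"
      using 4(1) Cons.prems(9) comm by auto
    obtain z' where z': "z' \<in> set xs" "{z, v} = {z', a}" "w' \<in> N z' \<inter> N a"
      using 4(2) Cons.prems(10) comm by auto
    have "x' \<noteq> z'" using x'(2) z'(2) Cons.prems(8) by auto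
    then show ?thesis using both x' z' by blast
  qed
qed simp

lemma spaced_copy_of_spread:
  assumes "spread s xs" "length xs = t"
  shows "spaced_copy t"
proof -
  define T where "T = set xs"
  \<comment> \<open>Any choice works, but it has to depend on the unordered pair only.\<close>
  define g where "g e = (SOME w. w \<in> (\<Inter>x\<in>e. N x))" for e
  have T: "T \<subseteq> A" "card T = t"
    using spread_distinct[OF assms(1)] assms(2) by (auto simp: T_def distinct_card)
  have g: "g {x, y} \<in> N x \<inter> N y" if "x \<in> T" "y \<in> T" "x \<noteq> y" for x y
  proof -
    have "\<exists>w. w \<in> (\<Inter>x\<in>{x, y}. N x)"
      using spread_light[OF assms(1), of x y] that by (auto simp: T_def light_def)
    then have "g {x, y} \<in> (\<Inter>x\<in>{x, y}. N x)" unfolding g_def by (rule someI_ex)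
    then show ?thesis by simp
  qed
  have "g e \<in> B \<and> (\<forall>x\<in>e. E x (g e))" if e: "e \<subseteq> T" "card e = 2" for e
  proof -
    obtain x y where "e = {x, y}" "x \<noteq> y" using e(2) by (auto simp: card_2_iff)
    then show ?thesis using g[of x y] e(1) by (auto simp: N_def)
  qed
  moreover have "\<not> conf (g e) (g e')"
    if e: "e \<subseteq> T" "card e = 2" "e' \<subseteq> T" "card e' = 2" "e \<noteq> e'" for e e'
  proof -
    obtain x y where xy: "e = {x, y}" "x \<noteq> y" using e(2) by (auto simp: card_2_iff)
    obtain z v where zv: "e' = {z, v}" "z \<noteq> v" using e(4) by (auto simp: card_2_iff)
    show ?thesis
      using spread_no_conf[OF assms(1), of x y z v "g e" "g e'"] g[of x y] g[of z v] xy zv e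
      by (auto simp: T_def)
  qed
  ultimately show ?thesis
    unfolding spaced_copy_def using T by (intro exI[of _ T] exI[of _ g]) simp
qed

text \<open>The vertices that cannot be added to \<open>xs\<close>, because a possible middle vertex \<open>w'\<close> of a new
  path would meet a possible middle vertex \<open>w\<close> of an old one. The case \<open>w = w'\<close> rules out
  common neighbours of three vertices.\<close>

definition bad :: "'a list \<Rightarrow> 'a set" where
  "bad xs = (\<Union>x\<in>set xs. \<Union>y\<in>set xs - {x}. \<Union>z\<in>set xs. \<Union>w\<in>N x \<inter> N y.
     \<Union>w'\<in>{w'\<in>B. E z w' \<and> conf w w'}. M w')"

lemma finite_bad: "finite (bad xs)"
  by (auto simp: bad_def finite_N finite_M finite_B)

text \<open>There are at most \<open>length xs\<close> choices for each of \<open>x\<close>,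
  \<open>y\<close> and \<open>z\<close>, fewer than \<open>s\<close> for \<open>w\<close> because
  \<open>x\<close> and \<open>y\<close> are light, at most two for \<open>w'\<close>, and at most
  \<open>d\<close> neighbours of \<open>w'\<close>. For bounded \<open>length xs\<close> and
  \<open>s\<close> this is linear in \<open>d\<close>.\<close>

lemma card_bad:
  assumes "spread s xs" and "\<And>w. w \<in> B \<Longrightarrow> card (M w) \<le> d"
  shows "card (bad xs) \<le> length xs * (length xs * (length xs * (s * (2 * d))))"
  unfolding bad_def
proof (rule card_UN_bound)
  fix x assume x: "x \<in> set xs"
  show "card (\<Union>y\<in>set xs - {x}. \<Union>z\<in>set xs. \<Union>w\<in>N x \<inter> N y.
      \<Union>w'\<in>{w'\<in>B. E z w' \<and> conf w w'}. M w') \<le> length xs * (length xs * (s * (2 * d)))"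
  proof (rule card_UN_bound)
    show "card (set xs - {x}) \<le> length xs"
      by (rule le_trans[OF card_mono[of "set xs"] card_length]) auto
    fix y assume y: "y \<in> set xs - {x}"
    show "card (\<Union>z\<in>set xs. \<Union>w\<in>N x \<inter> N y.
        \<Union>w'\<in>{w'\<in>B. E z w' \<and> conf w w'}. M w') \<le> length xs * (s * (2 * d))"
    proof (rule card_UN_bound)
      fix z assume z: "z \<in> set xs"
      show "card (\<Union>w\<in>N x \<inter> N y. \<Union>w'\<in>{w'\<in>B. E z w' \<and> conf w w'}. M w') \<le> s * (2 * d)"
      proof (rule card_UN_bound)
        show "card (N x \<inter> N y) \<le> s"
          using spread_light[OF assms(1), of x y] x y by (auto simp: light_def)
        fix w assume w: "w \<in> N x \<inter> N y"
        show "card (\<Union>w'\<in>{w'\<in>B. E z w' \<and> conf w w'}. M w') \<le> 2 * d"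
        proof (rule card_UN_bound)
          show "card {w'\<in>B. E z w' \<and> conf w w'} \<le> 2"
            using card_conf[of z w] spread_distinct[OF assms(1)] z w by (auto simp: N_def)
        qed (use finite_B assms(2) in auto)
      qed (simp add: finite_N)
    qed (simp_all add: card_length)
  qed simp
qed (simp_all add: card_length)

lemma extends_Cons:
  assumes "extends s xs v" "light s u v" "v \<notin> bad (u # xs)"
  shows "extends s (u # xs) v"
  unfolding extends_def
proof (intro conjI ballI impI notI)
  show "v \<in> A" using assms(1) by (simp add: extends_def)
  show "light s x v" if "x \<in> set (u # xs)" for x
    using assms(1,2) that by (auto simp: extends_def)
  fix x y z w w'
  assume *: "x \<in> set (u # xs)" "y \<in> set (u # xs)" "x \<noteq> y" "z \<in> set (u # xs)"
    "w \<in> N x \<inter> N y" "w' \<in> N z \<inter> N v" "conf w w'"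
  have "w' \<in> {w'\<in>B. E z w' \<and> conf w w'}" "v \<in> M w'"
    using * \<open>v \<in> A\<close> by (auto simp: N_def M_def)
  then have "v \<in> bad (u # xs)" unfolding bad_def using *(1-5) by blast
  then show False using assms(3) by simp
qed

section \<open>Building a light clique vertex by vertex\<close>

text \<open>A list \<open>xs\<close> is kept together with a set \<open>U\<close> of candidates for
  its next entry. A vertex \<open>u\<close> of \<open>U\<close> with many light partners in
  \<open>U\<close> is moved to the list, and these partners, minus the bad ones, become the new
  candidates. The assumption \<open>large\<close> guarantees that \<open>U\<close> is large enough
  to find \<open>u\<close> and that the bad vertices cost at most half of its partners.\<close>

lemma spaced_copy_exists:
  fixes \<delta> :: real and d t :: nat
  assumes t: "t \<ge> 2" and "\<delta> > 0" "B \<noteq> {}" and A: "card B / 2 \<le> card A"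
    and degA: "\<And>x. x \<in> A \<Longrightarrow> \<delta> \<le> card (N x) \<and> card (N x) \<le> d"
    and degB: "\<And>w. w \<in> B \<Longrightarrow> card (M w) \<le> d"
    and large: "\<And>i. i \<le> t - 2 \<Longrightarrow>
      8 * t ^ 8 * d * card B / \<delta>\<^sup>2 \<le> card B / 2 * (\<delta>\<^sup>2 / (4 * t ^ 3 * card B)) ^ i"
  shows "spaced_copy t"
proof (rule ccontr)
  assume no: "\<not> spaced_copy t"
  define m where "m = real (card B)"
  \<comment> \<open>Half of the proportion of light partners provided by
    \<open>exists_light_degree_ge\<close>; the other half pays for the bad vertices.\<close>
  define q where "q = \<delta>\<^sup>2 / (4 * t ^ 3 * m)"
  have m: "m > 0" using \<open>B \<noteq> {}\<close> finite_B by (auto simp: m_def card_gt_0_iff)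
  have q: "q > 0" using m t \<open>\<delta> > 0\<close> by (auto simp: q_def)
  have "\<exists>xs U. length xs = i \<and> spread (t\<^sup>2) xs \<and> U \<subseteq> A \<and> (\<forall>v\<in>U. extends (t\<^sup>2) xs v)
      \<and> m / 2 * q ^ i \<le> card U" if "i \<le> t - 1" for i
    using that
  proof (induction i)
    case 0
    show ?case by (rule exI[of _ "[]"], rule exI[of _ A]) (use A in \<open>auto simp: m_def extends_def\<close>)
  next
    case (Suc i)
    then obtain xs U where xs: "length xs = i" "spread (t\<^sup>2) xs" and U: "U \<subseteq> A"
      and ext: "\<And>v. v \<in> U \<Longrightarrow> extends (t\<^sup>2) xs v" and cU: "m / 2 * q ^ i \<le> card U" by auto
    have "m / 2 * q ^ i > 0" using m q by simp
    then have "U \<noteq> {}" using cU by auto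
    have cU': "8 * t ^ 8 * d * m / \<delta>\<^sup>2 \<le> card U"
    proof -
      have "i \<le> t - 2" using Suc.prems by simp
      then have "8 * t ^ 8 * d * m / \<delta>\<^sup>2 \<le> m / 2 * q ^ i"
        using large[of i] by (simp add: m_def q_def)
      then show ?thesis using cU by linarith
    qed
    have "2 * real d * t * m / \<delta>\<^sup>2 \<le> 8 * t ^ 8 * d * m / \<delta>\<^sup>2"
    proof -
      have "t \<le> t ^ 8" using t by (intro self_le_power) auto
      then have "2 * t \<le> 8 * t ^ 8" by linarith
      then have "real (2 * t) * (d * m) \<le> real (8 * t ^ 8) * (d * m)"
        using m by (intro mult_right_mono) (simp_all only: of_nat_le_iff, simp)
      then show ?thesis using \<open>\<delta> > 0\<close> by (simp add: field_simps)
    qed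
    moreover have "\<delta> \<le> card (N x) \<and> card (N x) \<le> real d" if "x \<in> A" for x
      using degA[OF that] by simp
    ultimately obtain u where u: "u \<in> U"
      "\<delta>\<^sup>2 * card U / (2 * t * t\<^sup>2 * card B) \<le> card {v\<in>U. light (t\<^sup>2) u v}"
      using exists_light_degree_ge[OF no _ \<open>\<delta> > 0\<close> \<open>B \<noteq> {}\<close> _ U \<open>U \<noteq> {}\<close>, of "real d"]
        t cU' unfolding m_def by force
    define V where "V = {v\<in>U. light (t\<^sup>2) u v} - bad (u # xs)"
    have sp: "spread (t\<^sup>2) (u # xs)" using xs ext[OF u(1)] by simp
    have "card (bad (u # xs)) \<le> Suc i * (Suc i * (Suc i * (t\<^sup>2 * (2 * d))))"
      using card_bad[OF sp degB] xs(1) by simp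
    also have "\<dots> \<le> t * (t * (t * (t\<^sup>2 * (2 * d))))"
      using Suc.prems by (intro mult_le_mono) auto
    finally have "real (card (bad (u # xs))) \<le> real (t * (t * (t * (t\<^sup>2 * (2 * d)))))"
      by (simp only: of_nat_le_iff)
    \<comment> \<open>Multiplying by the denominator \<open>4 * t ^ 3\<close> of \<open>q\<close>
      gives the constant \<open>8 * t ^ 8\<close> in \<open>large\<close>.\<close>
    also have "\<dots> = 2 * t ^ 5 * d" by (simp add: eval_nat_numeral algebra_simps)
    also have "\<dots> \<le> q * card U"
    proof -
      have "q * (8 * t ^ 8 * d * m / \<delta>\<^sup>2) \<le> q * card U" using cU' q by (intro mult_left_mono) auto
      moreover have "q * (8 * t ^ 8 * d * m / \<delta>\<^sup>2) = 2 * t ^ 5 * d"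
      proof -
        have t8: "real t ^ 8 = real t ^ 3 * real t ^ 5" by (simp flip: power_add)
        show ?thesis unfolding q_def using m t \<open>\<delta> > 0\<close>
          by (simp add: t8 del: power_add_numeral power_add_numeral2)
      qed
      ultimately show ?thesis by simp
    qed
    finally have cb: "real (card (bad (u # xs))) \<le> q * card U" .
    have "2 * q * card U = \<delta>\<^sup>2 * card U / (2 * t * t\<^sup>2 * card B)"
      using m t by (simp add: q_def m_def eval_nat_numeral field_simps)
    moreover have "card {v\<in>U. light (t\<^sup>2) u v} - card (bad (u # xs)) \<le> card V"
      unfolding V_def by (rule diff_card_le_card_Diff[OF finite_bad])
    ultimately have "q * card U \<le> card V" using u(2) cb by linarith
    moreover have "q * (m / 2 * q ^ i) \<le> q * card U" using cU q by (intro mult_left_mono) auto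
    ultimately have "m / 2 * q ^ Suc i \<le> card V" by (simp add: algebra_simps)
    moreover have "V \<subseteq> A" using U by (auto simp: V_def)
    moreover have "\<forall>v\<in>V. extends (t\<^sup>2) (u # xs) v"
      using ext extends_Cons by (auto simp: V_def)
    ultimately show ?case using xs(1) sp by (intro exI[of _ "u # xs"] exI[of _ V]) auto
  qed
  \<comment> \<open>After \<open>t - 1\<close> steps a nonempty candidate set suffices, as any
    candidate completes the clique. Hence \<open>large\<close> is invoked only up to
    \<open>t - 2\<close>.\<close>
  from this[of "t - 1"] obtain xs U where xs: "length xs = t - 1" "spread (t\<^sup>2) xs"
    and ext: "\<And>v. v \<in> U \<Longrightarrow> extends (t\<^sup>2) xs v" and cU: "m / 2 * q ^ (t - 1) \<le> card U" by auto
  have "m / 2 * q ^ (t - 1) > 0" using m q by simp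
  then have "U \<noteq> {}" using cU by auto
  then obtain v where "v \<in> U" by blast
  then have "spread (t\<^sup>2) (v # xs)" "length (v # xs) = t" using xs ext t by auto
  then show False using spaced_copy_of_spread no by blast
qed

end

section \<open>Isomorphic images and the auxiliary graph of a proper colouring\<close>

text \<open>As all edges are sets of vertices, injectivity of \<open>f\<close> on the vertices makes
  the image map injective on the relevant sets, so that non-edges stay non-edges. The isomorphism is
  the inverse of \<open>f\<close>.\<close>

lemma isomorphic_image:
  assumes "inj_on f (verts S)" "edges S \<subseteq> Pow (verts S)"
  shows "isomorphic \<lparr>verts = f ` verts S, edges = (`) f ` edges S\<rparr> S"
proof -
  define f' where "f' = inv_into (verts S) f"
  have f': "f' (f u) = u" if "u \<in> verts S" for u using that assms(1) by (simp add: f'_def)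
  have "{f u, f v} \<in> (`) f ` edges S \<longleftrightarrow> {u, v} \<in> edges S"
    if "u \<in> verts S" "v \<in> verts S" for u v
  proof -
    have "{u, v} \<in> Pow (verts S)" using that by simp
    then have "f ` {u, v} \<in> (`) f ` edges S \<longleftrightarrow> {u, v} \<in> edges S"
      using inj_on_image_mem_iff[OF inj_on_image_Pow[OF assms(1)]] assms(2) by blast
    then show ?thesis by simp
  qed
  moreover have "bij_betw f' (f ` verts S) (verts S)"
    unfolding f'_def by (intro bij_betw_inv_into inj_on_imp_bij_betw assms(1))
  ultimately show ?thesis
    unfolding isomorphic_def by (intro exI[of _ f']) (auto simp: f')
qed

lemma proper_colouring_complete_cancel:
  assumes "proper_edge_colouring (complete_graph n) \<chi>" "p < n" "a < n" "b < n"
    "p \<noteq> a" "p \<noteq> b" "\<chi> {p, a} = \<chi> {p, b}"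
  shows "a = b"
proof (rule ccontr)
  assume "a \<noteq> b"
  then have "{p, a} \<noteq> {p, b}" by (auto simp: doubleton_eq_iff)
  moreover have "{p, a} \<in> edges (complete_graph n)" "{p, b} \<in> edges (complete_graph n)"
    using assms by (auto simp: complete_graph_def)
  ultimately show False
    using assms(1)[unfolded proper_edge_colouring_def, rule_format, of "{p, a}" "{p, b}"] assms(7)
    by simp
qed

text \<open>First and second coordinates of the neighbours of \<open>x\<close> lie in different
  parts, so \<open>w\<close> and \<open>w'\<close> can only meet by agreeing in one coordinate. The
  colour of the edge to that coordinate is then shared by the two edges from \<open>x\<close> to the
  other coordinates, and properness makes these agree too.\<close>

lemma aux_graph_nbrs_disjoint:
  assumes col: "proper_edge_colouring (complete_graph n) \<chi>"
    and part: "partition_into (verts (complete_graph n)) [X\<^sub>1, X\<^sub>2, X\<^sub>3, X\<^sub>4]"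
    and e: "{x, w} \<in> edges (aux_graph \<chi> X\<^sub>1 X\<^sub>2 X\<^sub>3 X\<^sub>4)"
      "{x, w'} \<in> edges (aux_graph \<chi> X\<^sub>1 X\<^sub>2 X\<^sub>3 X\<^sub>4)"
    and meet: "\<not> disjnt (pair_set w) (pair_set w')"
  shows "w = w'"
proof -
  have lt: "a < n" if "a \<in> X\<^sub>1 \<union> X\<^sub>2 \<union> X\<^sub>3 \<union> X\<^sub>4" for a
    using part that by (auto simp: partition_into_def complete_graph_def)
  have disj: "X\<^sub>1 \<inter> X\<^sub>2 = {}" "X\<^sub>1 \<inter> X\<^sub>3 = {}" "X\<^sub>1 \<inter> X\<^sub>4 = {}" "X\<^sub>2 \<inter> X\<^sub>3 = {}"
    "X\<^sub>2 \<inter> X\<^sub>4 = {}" "X\<^sub>3 \<inter> X\<^sub>4 = {}"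
    using part by (auto simp: partition_into_def disjnt_def)
  \<comment> \<open>Edges are unordered, so \<open>x\<close> may lie on either side; both
    orientations are kept.\<close>
  have edge: "fst p \<in> X\<^sub>1 \<and> snd p \<in> X\<^sub>2 \<and> fst r \<in> X\<^sub>3 \<and> snd r \<in> X\<^sub>4 \<and>
        \<chi> {fst p, fst r} = \<chi> {snd p, snd r} \<or>
      fst r \<in> X\<^sub>1 \<and> snd r \<in> X\<^sub>2 \<and> fst p \<in> X\<^sub>3 \<and> snd p \<in> X\<^sub>4 \<and>
        \<chi> {fst p, fst r} = \<chi> {snd p, snd r}"
    if "{p, r} \<in> edges (aux_graph \<chi> X\<^sub>1 X\<^sub>2 X\<^sub>3 X\<^sub>4)" for p r
    using that by (auto simp: aux_graph_def doubleton_eq_iff insert_commute)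
  note e' = edge[OF e(1)] edge[OF e(2)]
  have same: "\<chi> {fst x, fst w} = \<chi> {snd x, snd w}" "\<chi> {fst x, fst w'} = \<chi> {snd x, snd w'}"
    using e' by blast+
  have bd: "fst x < n" "snd x < n" "fst w < n" "snd w < n" "fst w' < n" "snd w' < n"
    using e' lt by blast+
  have ne: "fst x \<noteq> fst w" "fst x \<noteq> fst w'" "snd x \<noteq> snd w" "snd x \<noteq> snd w'"
    "fst w \<noteq> snd w'" "snd w \<noteq> fst w'"
    using e' disj by (metis disjoint_iff)+
  have "fst w = fst w' \<or> snd w = snd w'"
    using meet ne by (auto simp: pair_set_def disjnt_def)
  then show ?thesis
  proof
    assume eq: "fst w = fst w'"
    then have "snd w = snd w'"
      using proper_colouring_complete_cancel[OF col bd(2,4,6) ne(3,4)] same by simp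
    then show ?thesis using eq by (simp add: prod_eq_iff)
  next
    assume eq: "snd w = snd w'"
    then have "fst w = fst w'"
      using proper_colouring_complete_cancel[OF col bd(1,3,5) ne(1,2)] same by simp
    then show ?thesis using eq by (simp add: prod_eq_iff)
  qed
qed

lemma degree_eq_card_nbrs:
  assumes "\<And>e. e \<in> edges G \<Longrightarrow> x \<in> e \<Longrightarrow> \<exists>w\<in>B. e = {x, w}"
  shows "degree G x = card {w\<in>B. {x, w} \<in> edges G}"
proof -
  have "{e\<in>edges G. x \<in> e} = (\<lambda>w. {x, w}) ` {w\<in>B. {x, w} \<in> edges G}"
    using assms by blast
  moreover have "inj_on (\<lambda>w. {x, w}) {w\<in>B. {x, w} \<in> edges G}"
    by (auto simp: inj_on_def doubleton_eq_iff)
  ultimately show ?thesis by (simp add: degree_def card_image)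
qed

section \<open>The numerical condition on the minimum degree\<close>

text \<open>If the base \<open>q\<close> on the right is at least 1, the left side is at most 1 and
  the bound is clear. Otherwise \<open>i = t - 2\<close> is the worst case, where the claim reads
  \<open>R * (a * m) ^ (t - 2) \<le> \<delta> ^ (2 * t - 3)\<close>; hence the exponent of
  \<open>m\<close>.\<close>

lemma density_power_bound:
  fixes K \<delta> :: real and t m i :: nat
  assumes "t \<ge> 3" "K \<ge> 1" "m \<ge> 1" "i \<le> t - 2"
    and \<delta>: "16 * t ^ 8 * K * (4 * t ^ 3) ^ (t - 2) * real m powr ((real t - 2) / (2 * real t - 3)) \<le> \<delta>"
  shows "16 * t ^ 8 * K / \<delta> \<le> (\<delta>\<^sup>2 / (4 * t ^ 3 * m)) ^ i"
proof -
  define R where "R = 16 * real t ^ 8 * K"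
  define a where "a = 4 * real t ^ 3"
  define p where "p = real m powr ((real t - 2) / (2 * real t - 3))"
  define q where "q = \<delta>\<^sup>2 / (a * m)"
  have t1: "real t ^ k \<ge> 1" for k using \<open>t \<ge> 3\<close> by (intro one_le_power) auto
  have a: "a \<ge> 1" using t1[of 3] by (simp add: a_def)
  have "1 * 1 \<le> (16 * real t ^ 8) * K" using t1[of 8] \<open>K \<ge> 1\<close> by (intro mult_mono) auto
  then have R: "R \<ge> 1" by (simp add: R_def)
  have p: "p \<ge> 1" unfolding p_def using assms(1,3) by (intro ge_one_powr_ge_zero) auto
  \<comment> \<open>The factor \<open>R\<close> pays for the numerator on the left and
    \<open>a ^ (t - 2)\<close> for the constant in the denominator of
    \<open>q ^ (t - 2)\<close>.\<close>
  define c where "c = R * a ^ (t - 2)"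
  have ap: "a ^ (t - 2) \<ge> 1" using a by (rule one_le_power)
  have cR: "c \<ge> R" using R ap mult_left_mono[of 1 "a ^ (t - 2)" R] by (simp add: c_def)
  have \<delta>': "c * p \<le> \<delta>" using \<delta> by (simp add: c_def R_def a_def p_def)
  have "c * 1 \<le> c * p" using p cR R by (intro mult_left_mono) auto
  then have \<delta>R: "\<delta> \<ge> R" using \<delta>' cR by linarith
  then have \<delta>0: "\<delta> > 0" using R by linarith
  have q0: "q > 0" using \<delta>0 a \<open>m \<ge> 1\<close> by (simp add: q_def)
  have "R / \<delta> \<le> q ^ i"
  proof (cases "q \<ge> 1")
    case True
    have "R / \<delta> \<le> 1" using \<delta>R \<delta>0 by simp
    also have "\<dots> \<le> q ^ i" using True by (rule one_le_power)
    finally show ?thesis .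
  next
    case False
    have pp: "p ^ (2 * t - 3) = real m ^ (t - 2)"
    proof -
      have "p ^ (2 * t - 3) = p powr real (2 * t - 3)" using p by (simp add: powr_realpow)
      also have "\<dots> = real m powr ((real t - 2) / (2 * real t - 3) * real (2 * t - 3))"
        by (simp add: p_def powr_powr)
      also have "(real t - 2) / (2 * real t - 3) * real (2 * t - 3) = real (t - 2)"
        using \<open>t \<ge> 3\<close> by (simp add: field_simps)
      also have "real m powr real (t - 2) = real m ^ (t - 2)"
        using \<open>m \<ge> 1\<close> by (simp add: powr_realpow)
      finally show ?thesis .
    qed
    \<comment> \<open>As \<open>c\<close> is at least 1, a single factor \<open>c\<close> of
      \<open>c ^ (2 * t - 3)\<close> is enough.\<close>
    have "c ^ 1 \<le> c ^ (2 * t - 3)" using cR R \<open>t \<ge> 3\<close> by (intro power_increasing) auto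
    then have "c * real m ^ (t - 2) \<le> c ^ (2 * t - 3) * real m ^ (t - 2)"
      by (intro mult_right_mono) auto
    also have "\<dots> = (c * p) ^ (2 * t - 3)" by (simp add: pp power_mult_distrib)
    also have "\<dots> \<le> \<delta> ^ (2 * t - 3)" using \<delta>' cR R p by (intro power_mono) auto
    also have "\<dots> = (\<delta>\<^sup>2) ^ (t - 2) * \<delta>"
    proof -
      have "2 * t - 3 = Suc (2 * (t - 2))" using \<open>t \<ge> 3\<close> by simp
      then show ?thesis by (simp add: power_mult)
    qed
    finally have "R * (a * m) ^ (t - 2) \<le> (\<delta>\<^sup>2) ^ (t - 2) * \<delta>"
      by (simp add: c_def power_mult_distrib mult.assoc)
    then have "R / \<delta> \<le> q ^ (t - 2)"
      using \<delta>0 a \<open>m \<ge> 1\<close> by (simp add: q_def field_simps)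
    also have "\<dots> \<le> q ^ i" using False q0 assms(4) by (intro power_decreasing) auto
    finally show ?thesis .
  qed
  then show ?thesis by (simp add: R_def q_def a_def)
qed

section \<open>Copies of the subdivided clique with pairwise disjoint vertices\<close>

theorem theorem2p4:
  fixes t :: nat and K :: real
  assumes "t \<ge> 3" and "K \<ge> 1"
  shows "\<exists>(c\<^sub>1::real) (m\<^sub>0::nat).
    \<forall>(n::nat) (\<chi> :: nat set \<Rightarrow> nat) X\<^sub>1 X\<^sub>2 X\<^sub>3 X\<^sub>4 (G\<^sub>0 :: (nat \<times> nat) graph) A B (m::nat) (\<delta>::real).
      proper_edge_colouring (complete_graph n) \<chi> \<longrightarrow>
      partition_into (verts (complete_graph n)) [X\<^sub>1, X\<^sub>2, X\<^sub>3, X\<^sub>4] \<longrightarrow>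
      subgraph G\<^sub>0 (aux_graph \<chi> X\<^sub>1 X\<^sub>2 X\<^sub>3 X\<^sub>4) \<longrightarrow>
      bipartite_with G\<^sub>0 A B \<longrightarrow>
      (A \<subseteq> X\<^sub>1 \<times> X\<^sub>2 \<and> B \<subseteq> X\<^sub>3 \<times> X\<^sub>4) \<or> (A \<subseteq> X\<^sub>3 \<times> X\<^sub>4 \<and> B \<subseteq> X\<^sub>1 \<times> X\<^sub>2) \<longrightarrow>
      card B = m \<longrightarrow> m \<ge> m\<^sub>0 \<longrightarrow>
      (1/2) * real (card B) \<le> real (card A) \<longrightarrow> real (card A) \<le> 2 * real (card B) \<longrightarrow>
      (\<forall>v\<in>verts G\<^sub>0. \<delta> \<le> real (degree G\<^sub>0 v) \<and> real (degree G\<^sub>0 v) \<le> K * \<delta>) \<longrightarrow>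
      \<delta> \<ge> c\<^sub>1 * real m powr ((real t - 2) / (2 * real t - 3)) \<longrightarrow>
      (\<exists>H. subgraph H G\<^sub>0 \<and> isomorphic H (subdivided_clique t) \<and> pairwise_disjoint_verts H)"
\<comment> \<open>The first witness is the constant of \<open>density_power_bound\<close>. With
  \<open>m\<^sub>0 = 1\<close> the set \<open>B\<close> is nonempty and the lower bound on
  \<open>\<delta>\<close> is positive.\<close>
proof (rule exI[of _ "16 * t ^ 8 * K * (4 * t ^ 3) ^ (t - 2)"], rule exI[of _ 1], intro allI impI)
  fix n :: nat and \<chi> :: "nat set \<Rightarrow> nat" and X\<^sub>1 X\<^sub>2 X\<^sub>3 X\<^sub>4 and G\<^sub>0 :: "(nat \<times> nat) graph"
    and A B and m :: nat and \<delta> :: real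
  assume col: "proper_edge_colouring (complete_graph n) \<chi>"
    and part: "partition_into (verts (complete_graph n)) [X\<^sub>1, X\<^sub>2, X\<^sub>3, X\<^sub>4]"
    and sub: "subgraph G\<^sub>0 (aux_graph \<chi> X\<^sub>1 X\<^sub>2 X\<^sub>3 X\<^sub>4)"
    and bip: "bipartite_with G\<^sub>0 A B"
    and sides: "(A \<subseteq> X\<^sub>1 \<times> X\<^sub>2 \<and> B \<subseteq> X\<^sub>3 \<times> X\<^sub>4) \<or> (A \<subseteq> X\<^sub>3 \<times> X\<^sub>4 \<and> B \<subseteq> X\<^sub>1 \<times> X\<^sub>2)"
    and m: "card B = m" "m \<ge> 1"
    and half: "(1/2) * real (card B) \<le> real (card A)" and "real (card A) \<le> 2 * real (card B)"
    and deg: "\<forall>v\<in>verts G\<^sub>0. \<delta> \<le> real (degree G\<^sub>0 v) \<and> real (degree G\<^sub>0 v) \<le> K * \<delta>"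
    and \<delta>: "\<delta> \<ge> 16 * t ^ 8 * K * (4 * t ^ 3) ^ (t - 2) *
      real m powr ((real t - 2) / (2 * real t - 3))"
  define E where "E x w \<longleftrightarrow> {x, w} \<in> edges G\<^sub>0" for x w
  define conf where "conf w w' \<longleftrightarrow> \<not> disjnt (pair_set w) (pair_set w')" for w w' :: "nat \<times> nat"
  have AB: "verts G\<^sub>0 = A \<union> B" "A \<inter> B = {}" and
    edgeAB: "\<And>e. e \<in> edges G\<^sub>0 \<Longrightarrow> \<exists>a\<in>A. \<exists>b\<in>B. e = {a, b}"
    using bip by (auto simp: bipartite_with_def)
  have nbrs: "w = w'" if "E x w" "E x w'" "conf w w'" for x w w'
  proof (rule aux_graph_nbrs_disjoint[OF col part])
    show "{x, w} \<in> edges (aux_graph \<chi> X\<^sub>1 X\<^sub>2 X\<^sub>3 X\<^sub>4)"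
      "{x, w'} \<in> edges (aux_graph \<chi> X\<^sub>1 X\<^sub>2 X\<^sub>3 X\<^sub>4)"
      using sub that by (auto simp: E_def subgraph_def)
  qed (use that in \<open>simp add: conf_def\<close>)
  have lt: "X\<^sub>1 \<subseteq> {..<n}" "X\<^sub>2 \<subseteq> {..<n}" "X\<^sub>3 \<subseteq> {..<n}" "X\<^sub>4 \<subseteq> {..<n}"
    using part by (auto simp: partition_into_def complete_graph_def)
  have fin: "finite A" "finite B"
  proof -
    have "A \<subseteq> {..<n} \<times> {..<n}" "B \<subseteq> {..<n} \<times> {..<n}" using sides lt by blast+
    then show "finite A" "finite B" by (simp_all add: finite_subset)
  qed
  have conf_AB: "\<not> conf x w" if "x \<in> A" "w \<in> B" for x w
  proof -
    have "pair_set x \<subseteq> X\<^sub>1 \<union> X\<^sub>2 \<and> pair_set w \<subseteq> X\<^sub>3 \<union> X\<^sub>4 \<or>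
        pair_set x \<subseteq> X\<^sub>3 \<union> X\<^sub>4 \<and> pair_set w \<subseteq> X\<^sub>1 \<union> X\<^sub>2"
      using sides that by (auto simp: pair_set_def mem_Times_iff)
    moreover have "(X\<^sub>1 \<union> X\<^sub>2) \<inter> (X\<^sub>3 \<union> X\<^sub>4) = {}"
      using part by (auto simp: partition_into_def disjnt_def)
    ultimately show ?thesis unfolding conf_def disjnt_def by blast
  qed
  have conf_sym: "conf w w' \<Longrightarrow> conf w' w" for w w'
    by (auto simp: conf_def disjnt_def)
  interpret conflict_bipartite A B E conf
  proof
    show "conf w w" for w by (simp add: conf_def pair_set_def)
    show "w = w'" if "E x w" "E x w'" "conf w w'" for x w w' using nbrs that .
    fix x w
    \<comment> \<open>Two neighbours of \<open>x\<close> containing the same point \<open>a\<close>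
      meet and so coincide. A pair \<open>w\<close> has only two points.\<close>
    define F where "F a = {w'\<in>B. E x w' \<and> a \<in> pair_set w'}" for a
    have "card (F a) \<le> 1" for a
    proof -
      have "w = w'" if "w \<in> F a" "w' \<in> F a" for w w'
      proof (rule nbrs)
        show "E x w" "E x w'" using that by (auto simp: F_def)
        show "conf w w'" using that by (auto simp: F_def conf_def disjnt_def)
      qed
      then show ?thesis using fin by (simp add: card_le_Suc0_iff_eq F_def)
    qed
    moreover have "{w'\<in>B. E x w' \<and> conf w w'} \<subseteq> F (fst w) \<union> F (snd w)"
      by (auto simp: F_def conf_def pair_set_def disjnt_def)
    then have "card {w'\<in>B. E x w' \<and> conf w w'} \<le> card (F (fst w) \<union> F (snd w))"
      by (rule card_mono[rotated]) (use fin in \<open>simp add: F_def\<close>)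
    ultimately show "card {w'\<in>B. E x w' \<and> conf w w'} \<le> 2"
      using card_Un_le[of "F (fst w)" "F (snd w)"] by (smt (verit) add_mono le_trans one_add_one)
  qed (fact fin conf_sym)+
  \<comment> \<open>Degrees are integers, so the bound \<open>K * \<delta>\<close> may be rounded
    down to a natural number.\<close>
  define d where "d = nat \<lfloor>K * \<delta>\<rfloor>"
  have "0 < 16 * t ^ 8 * K * (4 * t ^ 3) ^ (t - 2) *
      real m powr ((real t - 2) / (2 * real t - 3))"
    using assms m(2) by simp
  then have \<delta>0: "\<delta> > 0" using \<delta> by linarith
  have d: "real d \<le> K * \<delta>" using \<delta>0 \<open>K \<ge> 1\<close> by (simp add: d_def)
  have le_d: "k \<le> d" if "real k \<le> K * \<delta>" for k
    using that unfolding d_def by (simp add: le_nat_iff le_floor_iff)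
  have degN: "degree G\<^sub>0 x = card (N x)" if "x \<in> A" for x
    unfolding N_def E_def
    by (rule degree_eq_card_nbrs) (use that AB edgeAB in \<open>auto dest!: edgeAB\<close>)
  have degM: "degree G\<^sub>0 w = card (M w)" if "w \<in> B" for w
  proof -
    have "degree G\<^sub>0 w = card {x\<in>A. {w, x} \<in> edges G\<^sub>0}"
      by (rule degree_eq_card_nbrs) (use that AB in \<open>auto dest!: edgeAB\<close>)
    then show ?thesis by (simp add: M_def E_def insert_commute)
  qed
  have "spaced_copy t"
  proof (rule spaced_copy_exists[where \<delta> = \<delta> and d = d])
    show "B \<noteq> {}" using m by auto
    show "card B / 2 \<le> card A" using half by simp
    show "\<delta> \<le> card (N x) \<and> card (N x) \<le> d" if "x \<in> A" for x
      using deg[rule_format, of x] degN[OF that] le_d that AB(1) by auto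
    show "card (M w) \<le> d" if "w \<in> B" for w
      using deg[rule_format, of w] degM[OF that] le_d that AB(1) by auto
    fix i assume i: "i \<le> t - 2"
    have "8 * t ^ 8 * d * card B / \<delta>\<^sup>2 = 8 * real t ^ 8 * m / \<delta>\<^sup>2 * real d"
      by (simp add: m)
    also have "\<dots> \<le> 8 * real t ^ 8 * m / \<delta>\<^sup>2 * (K * \<delta>)" using d by (intro mult_left_mono) auto
    \<comment> \<open>Splitting off \<open>m / 2\<close>, the lower bound for \<open>card A\<close>,
      turns the factor 8 into the 16 of the constant.\<close>
    also have "\<dots> = real m / 2 * (16 * t ^ 8 * K / \<delta>)"
      using \<delta>0 by (simp add: field_simps power2_eq_square)
    also have "\<dots> \<le> real m / 2 * (\<delta>\<^sup>2 / (4 * t ^ 3 * m)) ^ i"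
      using density_power_bound[OF assms m(2) i \<delta>] by (intro mult_left_mono) auto
    finally show "8 * t ^ 8 * d * card B / \<delta>\<^sup>2 \<le>
        card B / 2 * (\<delta>\<^sup>2 / (4 * t ^ 3 * card B)) ^ i"
      by (simp add: m)
  qed (use assms \<delta>0 in auto)
  then obtain T g where T: "T \<subseteq> A" "card T = t"
    and g_all: "\<forall>e. e \<subseteq> T \<and> card e = 2 \<longrightarrow> g e \<in> B \<and> (\<forall>x\<in>e. E x (g e))"
    and gconf: "\<forall>e e'. e \<subseteq> T \<and> card e = 2 \<and> e' \<subseteq> T \<and> card e' = 2 \<and> e \<noteq> e' \<longrightarrow>
      \<not> conf (g e) (g e')"
    unfolding spaced_copy_def by (elim exE conjE)
  have g: "g e \<in> B \<and> (\<forall>x\<in>e. E x (g e))" if "e \<subseteq> T" "card e = 2" for e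
    using g_all that by blast
  obtain h where h: "bij_betw h {..<t} T"
    using ex_bij_betw_nat_finite[of T] T fin(1) finite_subset
    by (metis atLeast0LessThan)
  define S where "S = subdivided_clique t"
  define P where "P = {e. e \<subseteq> {..<t} \<and> card e = 2}"
  \<comment> \<open>Branch vertices are placed by \<open>h\<close>, and the middle vertex of
    \<open>e\<close> goes to the one chosen for the image pair \<open>h\<close> together with its
    elements' order forgotten.\<close>
  define f where "f = case_sum h (\<lambda>e. g (h ` e))"
  have vertsS: "verts S = Inl ` {..<t} \<union> Inr ` P"
    and edgesS: "edges S = {{Inl v, Inr e} | v e. e \<in> P \<and> v \<in> e}"
    by (simp_all add: S_def subdivided_clique_def subdivision1_def complete_graph_def P_def)
  have hT: "h v \<in> T" if "v < t" for v using h that by (auto simp: bij_betw_def)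
  have hP: "h ` e \<subseteq> T" "card (h ` e) = 2" if "e \<in> P" for e
  proof -
    have "inj_on h e" using h that by (auto simp: P_def bij_betw_def intro: inj_on_subset)
    then show "card (h ` e) = 2" using that by (simp add: card_image P_def)
    show "h ` e \<subseteq> T" using hT that by (auto simp: P_def)
  qed
  have hinj: "h ` e \<noteq> h ` e'" if "e \<in> P" "e' \<in> P" "e \<noteq> e'" for e e'
    using that h inj_on_image_eq_iff[of h "{..<t}" e e'] by (auto simp: P_def bij_betw_def)
  have noconf: "\<not> conf (f p) (f p')" if "p \<in> verts S" "p' \<in> verts S" "p \<noteq> p'" for p p'
  proof -
    \<comment> \<open>The middle vertex chosen for \<open>h u\<close> and \<open>h v\<close> is
      adjacent to both, and neighbours of one vertex conflict only if they are equal.\<close>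
    have ll: "\<not> conf (h u) (h v)" if "u < t" "v < t" "u \<noteq> v" for u v
    proof
      assume c: "conf (h u) (h v)"
      have ne: "h u \<noteq> h v" using h that by (auto simp: bij_betw_def inj_on_def)
      then have "E (h u) (g {h u, h v}) \<and> E (h v) (g {h u, h v})"
        using g[of "{h u, h v}"] hT that by auto
      then have "E (g {h u, h v}) (h u)" "E (g {h u, h v}) (h v)"
        by (simp_all add: E_def insert_commute)
      then show False using nbrs c ne by blast
    qed
    have lr: "\<not> conf (h u) (g (h ` e))" if "u < t" "e \<in> P" for u e
      using conf_AB hT T(1) g hP that by blast
    have rr: "\<not> conf (g (h ` e)) (g (h ` e'))" if "e \<in> P" "e' \<in> P" "e \<noteq> e'" for e e'
      using gconf[rule_format, of "h ` e" "h ` e'"] hP[OF that(1)] hP[OF that(2)] hinj[OF that]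
      by simp
    have rl: "\<not> conf (g (h ` e)) (h u)" if "u < t" "e \<in> P" for u e
      using lr[OF that] conf_sym by blast
    show ?thesis
      by (cases p; cases p') (use that ll lr rl rr in \<open>simp_all add: vertsS f_def image_iff\<close>)
  qed
  \<comment> \<open>Two vertices with the same image would conflict, as \<open>conf\<close> is
    reflexive.\<close>
  have "inj_on f (verts S)"
    using noconf conf_refl by (metis inj_onI)
  define H where "H = \<lparr>verts = f ` verts S, edges = (`) f ` edges S\<rparr>"
  have "isomorphic H S"
    unfolding H_def
    by (rule isomorphic_image[OF \<open>inj_on f (verts S)\<close>]) (auto simp: vertsS edgesS P_def)
  moreover have "pairwise_disjoint_verts H"
    using noconf by (auto simp: pairwise_disjoint_verts_def pairwise_def H_def conf_def)
  moreover have "subgraph H G\<^sub>0"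
  proof -
    have "f ` verts S \<subseteq> verts G\<^sub>0"
      using hT T(1) g hP AB(1) by (auto simp: vertsS f_def)
    moreover have "e \<in> edges G\<^sub>0 \<and> e \<subseteq> f ` verts S \<and> card e = 2" if "e \<in> (`) f ` edges S" for e
    proof -
      obtain v p where "e = f ` {Inl v, Inr p}" and p: "p \<in> P" "v \<in> p"
        using \<open>e \<in> (`) f ` edges S\<close> unfolding edgesS by blast
      then have vp: "e = {h v, g (h ` p)}" "p \<in> P" "v \<in> p" by (simp_all add: f_def)
      have "v < t" using vp by (auto simp: P_def)
      have "E (h v) (g (h ` p))" using g[OF hP[OF vp(2)]] vp(3) by blast
      moreover have "h v \<noteq> g (h ` p)"
        using hT[OF \<open>v < t\<close>] T(1) g[OF hP[OF vp(2)]] AB(2) by (metis disjoint_iff subsetD)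
      moreover have "f (Inl v) \<in> f ` verts S" "f (Inr p) \<in> f ` verts S"
        using vp(2) \<open>v < t\<close> by (simp_all add: vertsS)
      then have "h v \<in> f ` verts S" "g (h ` p) \<in> f ` verts S" by (simp_all add: f_def)
      ultimately show ?thesis using vp(1) by (simp add: E_def)
    qed
    ultimately show ?thesis unfolding subgraph_def simple_graph_def H_def by auto
  qed
  ultimately show "\<exists>H. subgraph H G\<^sub>0 \<and> isomorphic H (subdivided_clique t) \<and> pairwise_disjoint_verts H"
    unfolding S_def by blast
qed

end
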